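(* Let $R=\mathbb C[[x,y]]$ with maximal ideal $\mathfrak m=(x,y)$, and set $\mathfrak q=\mathfrak m$. Then there exist filtrations $\mathfrak a_\bullet=\{\mathfrak a_p\}_{p\ge1}$ and $\mathfrak b_\bullet=\{\mathfrak b_p\}_{p\ge1}$ of ideals of $R$, satisfying for some constants $c,C,d,D>0$ the linear boundedness conditions $$\mathfrak q^{\lceil cp\rceil}\subseteq\mathfrak a_p\subseteq\mathfrak q^{\lfloor Cp\rfloor}\quad\text{and}\quad\mathfrak q^{\lceil dp\rceil}\subseteq\mathfrak b_p\subseteq\mathfrak q^{\lfloor Dp\rfloor}\quad\text{for all }p\ge1,$$ such that $$\sup_{v\in\operatorname{Val}_{\mathfrak m}(\mathfrak q)}\frac{v(\mathfrak a_\bullet)}{v(\mathfrak b_\bullet)}$$ is attained by a valuation $v_*\in\operatorname{Val}_{\mathfrak m}(\mathfrak q)$ which is not divisorial, and moreover no divisorial valuation in $\operatorname{Val}_{\mathfrak m}(\mathfrak q)$ attains this supremum.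
   Context: Ideals are always proper. A filtration is a family $\{\mathfrak a_p\}_{p\ge1}$ of ideals with $\mathfrak a_p\mathfrak a_{p'}\subseteq\mathfrak a_{p+p'}$ and $\mathfrak a_{p+1}\subseteq\mathfrak a_p$ for all $p,p'\ge1$. A real (semi)valuation on $R$ centered at $\mathfrak m$ is a map $v:R\to[0,\infty]$ with $v(0)=\infty$, $v(xy)=v(x)+v(y)$, $v(x+y)\ge\min\{v(x),v(y)\}$, and $v(x)>0$ for all $x\in\mathfrak m$ (and $v=0$ on units). $\operatorname{Val}_{\mathfrak m}$ is the set of these, and $\operatorname{Val}_{\mathfrak m}(\mathfrak q):=\{v\in\operatorname{Val}_{\mathfrak m}:v(\mathfrak q)=1\}$. Here $v(I):=\min\{v(x):x\in I\}$ and $v(\mathfrak a_\bullet):=\lim_{p\to\infty}\frac{v(\mathfrak a_p)}p=\inf_{p\ge1}\frac{v(\mathfrak a_p)}p$. A valuation is divisorial if it is a positive real multiple of $\operatorname{ord}_E$ for a prime divisor $E$ on some normal scheme proper and birational over $\operatorname{Spec}R$. *)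

theory Defs
  imports
    "HOL-Algebra.Algebraic_Closure_Type"
    "HOL-Algebra.Generated_Rings"
    "HOL-Algebra.Ideal_Product"
    "HOL-Computational_Algebra.Computational_Algebra"
    "HOL-Library.Extended_Nonnegative_Real"
begin

section \<open>The ring of power series in two variables\<close>

text \<open>
  The type \<^typ>\<open>complex fps fps\<close> is C[[x]][[y]] = C[[x,y]]; the coefficient of
  x^i y^j in f is \<open>f $ j $ i\<close>.  Ideals, their products and their powers are those of
  HOL-Algebra, applied to the ring structure of the type.
\<close>

type_synonym power_series2 = "complex fps fps"

definition power_series_ring2 :: "power_series2 ring" where
  "power_series_ring2 = ring_of_type_algebra"

definition var_x :: power_series2 where "var_x = fps_const fps_X"

definition var_y :: power_series2 where "var_y = fps_X"

definition max_ideal2 :: "power_series2 set" where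
  "max_ideal2 = genideal power_series_ring2 {var_x, var_y}"

definition ideal_power :: "('a, 'b) ring_scheme \<Rightarrow> 'a set \<Rightarrow> nat \<Rightarrow> 'a set" where
  "ideal_power R I n = I [^]\<^bsub>ideals_set R\<^esub> n"


section \<open>Filtrations\<close>

text \<open>
  A filtration is indexed by p \<open>\<ge>\<close> 1; the value at 0 of the function encoding it is
  irrelevant.  Ideals are proper by convention.
\<close>

definition filtration :: "('a, 'b) ring_scheme \<Rightarrow> (nat \<Rightarrow> 'a set) \<Rightarrow> bool" where
  "filtration R a \<longleftrightarrow>
     (\<forall>p\<ge>1. ideal (a p) R \<and> a p \<noteq> carrier R) \<and>
     (\<forall>p\<ge>1. \<forall>p'\<ge>1. ideal_prod R (a p) (a p') \<subseteq> a (p + p')) \<and>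
     (\<forall>p\<ge>1. a (p + 1) \<subseteq> a p)"


section \<open>Semivaluations\<close>

definition Val :: "'a::comm_ring_1 set \<Rightarrow> ('a \<Rightarrow> ennreal) set" where
  "Val \<mm> = {v. v 0 = \<infinity> \<and>
              (\<forall>x y. v (x * y) = v x + v y) \<and>
              (\<forall>x y. v (x + y) \<ge> min (v x) (v y)) \<and>
              (\<forall>x\<in>\<mm>. v x > 0) \<and>
              (\<forall>x. x dvd 1 \<longrightarrow> v x = 0)}"

text \<open>
  In a Noetherian ring the infimum below is attained; see \<open>val_ideal_genideal\<close>.
\<close>

definition val_ideal :: "('a \<Rightarrow> ennreal) \<Rightarrow> 'a set \<Rightarrow> ennreal" where
  "val_ideal v I = (INF x\<in>I. v x)"

definition Val_normalized :: "'a::comm_ring_1 set \<Rightarrow> 'a set \<Rightarrow> ('a \<Rightarrow> ennreal) set" where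
  "Val_normalized \<mm> \<qq> = {v \<in> Val \<mm>. val_ideal v \<qq> = 1}"

definition val_filtration :: "('a \<Rightarrow> ennreal) \<Rightarrow> (nat \<Rightarrow> 'a set) \<Rightarrow> ennreal" where
  "val_filtration v a = lim (\<lambda>p. val_ideal v (a p) / of_nat p)"


section \<open>Divisorial valuations\<close>

text \<open>
  Let R be an integral domain with fraction field K.  An integral scheme Y that is separated,
  of finite type and birational over Spec R is determined by the set of its local rings,
  viewed as subrings of K (a \<^emph>\<open>model\<close> of K over R in the sense of Zariski).  Locally
  Y is Spec A for a finitely generated R-subalgebra A of K, whose local rings are the
  localizations of A at its primes.  By the valuative criterion, a finite union of such affine
  models comes from a scheme proper over Spec R iff every valuation ring of K that contains R
  dominates exactly one member.  The points of Y correspond to the members of the model,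
  prime divisors to the one-dimensional ones.
\<close>

definition fraction :: "'a::idom \<Rightarrow> 'a fract" where
  "fraction f = Fraction_Field.Fract f 1"

definition ring_on :: "'k::field set \<Rightarrow> 'k ring" where
  "ring_on A = ring_of_type_algebra\<lparr>carrier := A\<rparr>"

definition finitely_generated_subalgebra :: "'a::idom fract set \<Rightarrow> bool" where
  "finitely_generated_subalgebra A \<longleftrightarrow>
     (\<exists>S. finite S \<and> A = generate_ring ring_of_type_algebra (range fraction \<union> S))"

definition localization_at :: "'k::field set \<Rightarrow> 'k set \<Rightarrow> 'k set" where
  "localization_at A P = {a / s | a s. a \<in> A \<and> s \<in> A - P}"

definition affine_model :: "'k::field set \<Rightarrow> 'k set set" where
  "affine_model A = {localization_at A P | P. primeideal P (ring_on A)}"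

text \<open>For a local subring of K, this is its maximal ideal.\<close>

definition nonunits :: "'k::field set \<Rightarrow> 'k set" where
  "nonunits B = B - Units (ring_on B)"

definition valuation_subring :: "'k::field set \<Rightarrow> bool" where
  "valuation_subring V \<longleftrightarrow>
     subring V ring_of_type_algebra \<and> (\<forall>z. z \<noteq> 0 \<longrightarrow> z \<in> V \<or> inverse z \<in> V)"

definition dominates :: "'k::field set \<Rightarrow> 'k set \<Rightarrow> bool" where
  "dominates V B \<longleftrightarrow> B \<subseteq> V \<and> nonunits B = nonunits V \<inter> B"

definition proper_birational_model :: "'a::idom fract set set \<Rightarrow> bool" where
  "proper_birational_model M \<longleftrightarrow>
     (\<exists>\<A>. finite \<A> \<and> (\<forall>A\<in>\<A>. finitely_generated_subalgebra A) \<and>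
          M = (\<Union>A\<in>\<A>. affine_model A)) \<and>
     (\<forall>V. valuation_subring V \<and> range fraction \<subseteq> V \<longrightarrow> (\<exists>!B. B \<in> M \<and> dominates V B))"

definition integrally_closed :: "'k::field set \<Rightarrow> bool" where
  "integrally_closed B \<longleftrightarrow>
     (\<forall>z. (\<exists>f. lead_coeff f = 1 \<and> set (coeffs f) \<subseteq> B \<and> poly f z = 0) \<longrightarrow> z \<in> B)"

definition normal_model :: "'k::field set set \<Rightarrow> bool" where
  "normal_model M \<longleftrightarrow> (\<forall>B\<in>M. integrally_closed B)"

text \<open>A local domain has dimension one iff it has exactly two primes, zero and the maximal ideal.\<close>

definition prime_divisor :: "'k::field set set \<Rightarrow> 'k set \<Rightarrow> bool" where
  "prime_divisor M B \<longleftrightarrow> B \<in> M \<and> nonunits B \<noteq> {0} \<and>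
     {P. primeideal P (ring_on B)} = {{0}, nonunits B}"

text \<open>
  The order of vanishing along the prime divisor with local ring B (a discrete valuation ring
  when the model is normal).  It is \<open>\<infinity>\<close> at 0.
\<close>

definition ord_along :: "'a::idom fract set \<Rightarrow> 'a \<Rightarrow> ennreal" where
  "ord_along B f = (SUP n\<in>{n. fraction f \<in> ideal_power (ring_on B) (nonunits B) n}. of_nat n)"

definition divisorial :: "('a::idom \<Rightarrow> ennreal) \<Rightarrow> bool" where
  "divisorial v \<longleftrightarrow>
     (\<exists>M B c. proper_birational_model M \<and> normal_model M \<and> prime_divisor M B \<and>
              0 < c \<and> (\<forall>f. v f = ennreal c * ord_along B f))"


section \<open>Consistency of the definitions\<close>

lemma val_ideal_genideal:
  fixes v :: "'a::comm_ring_1 \<Rightarrow> ennreal"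
  assumes v: "v \<in> Val \<mm>" and S: "finite S" "S \<noteq> {}"
  shows "val_ideal v (genideal ring_of_type_algebra S) = Min (v ` S)"
proof -
  let ?R = "ring_of_type_algebra :: 'a ring"
  interpret R: cring ?R by (rule cring_from_type_algebra)
  have carr: "carrier ?R = UNIV" by (simp add: ring_of_type_algebra_def)
  have mult: "x \<otimes>\<^bsub>?R\<^esub> y = x * y" and add: "x \<oplus>\<^bsub>?R\<^esub> y = x + y"
    and zero: "\<zero>\<^bsub>?R\<^esub> = 0" for x y
    by (simp_all add: ring_of_type_algebra_def)
  have v0: "v 0 = Orderings.top" and vm: "v (x * y) = v x + v y" and va: "v (x + y) \<ge> min (v x) (v y)"
    for x y
    using v by (auto simp: Val_def)
  let ?m = "Min (v ` S)"
  let ?I = "{x. ?m \<le> v x}"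
  have "\<ominus>\<^bsub>?R\<^esub> x = (-1) * x" for x
    by (rule R.minus_equality) (simp_all add: carr add zero)
  hence "v (\<ominus>\<^bsub>?R\<^esub> x) = v (-1) + v x" for x by (simp only: vm)
  hence minus: "?m \<le> v (\<ominus>\<^bsub>?R\<^esub> x)" if "?m \<le> v x" for x
    using that by (simp only: add_increasing zero_le)
  have plus: "?m \<le> v (x + y)" if "?m \<le> v x" "?m \<le> v y" for x y
    using that va[of x y] by (meson min.boundedI order_trans)
  have times: "?m \<le> v (x * y)" if "?m \<le> v x \<or> ?m \<le> v y" for x y
    unfolding vm using that
    by (elim disjE) (blast intro: add_increasing add_increasing2 zero_le)+
  have "ideal ?I ?R"
  proof (rule idealI)
    show "subgroup ?I (add_monoid ?R)"
    proof (rule R.add.subgroupI)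
      show "?I \<subseteq> carrier ?R" by (simp add: carr)
      show "?I \<noteq> {}" using v0 by (auto intro: exI[of _ 0])
      show "\<ominus>\<^bsub>?R\<^esub> x \<in> ?I" if "x \<in> ?I" for x using that minus by blast
      show "x \<oplus>\<^bsub>?R\<^esub> y \<in> ?I" if "x \<in> ?I" "y \<in> ?I" for x y
        using that plus by (simp only: add mem_Collect_eq)
    qed
    show "x \<otimes>\<^bsub>?R\<^esub> a \<in> ?I" if "a \<in> ?I" for a x
      unfolding mult using that times[of x a] by blast
    show "a \<otimes>\<^bsub>?R\<^esub> x \<in> ?I" if "a \<in> ?I" for a x
      unfolding mult using that times[of a x] by blast
  qed (rule R.ring_axioms)
  moreover have "S \<subseteq> ?I"
  proof
    fix s assume "s \<in> S"
    hence "?m \<le> v s" using S(1) by (intro Min_le) auto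
    thus "s \<in> ?I" by simp
  qed
  ultimately have sub: "genideal ?R S \<subseteq> ?I"
    by (rule R.genideal_minimal)
  have "?m \<in> v ` S" using S by (intro Min_in) auto
  then obtain s where s: "s \<in> S" "?m = v s" by (rule imageE)
  have "S \<subseteq> genideal ?R S" by (rule R.genideal_self) (simp add: carr)
  with s have "val_ideal v (genideal ?R S) \<le> ?m"
    unfolding val_ideal_def by (metis INF_lower subsetD)
  moreover have "?m \<le> val_ideal v (genideal ?R S)"
    unfolding val_ideal_def using sub by (intro INF_greatest) blast
  ultimately show ?thesis by (rule antisym)
qed

lemma INF_add_const_ennreal:
  fixes f :: "'a \<Rightarrow> ennreal"
  assumes "A \<noteq> {}"
  shows "(INF i\<in>A. f i + c) = (INF i\<in>A. f i) + c"
  using continuous_at_Inf_mono[of "\<lambda>x. x + c" "f ` A"] assms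
    continuous_add[of "at_right (Inf (f ` A))", of "\<lambda>x. x" "\<lambda>x. c"]
  by (auto simp: mono_def image_comp comp_def add_right_mono)

lemma ennreal_subadditive_limit:
  fixes f :: "nat \<Rightarrow> ennreal"
  assumes sub: "\<And>m n. m \<ge> 1 \<Longrightarrow> n \<ge> 1 \<Longrightarrow> f (m + n) \<le> f m + f n"
    and fin: "\<And>n. n \<ge> 1 \<Longrightarrow> f n < Orderings.top"
  shows "(\<lambda>n. f n / of_nat n) \<longlonglongrightarrow> (INF n\<in>{1..}. f n / of_nat n)"
proof (rule order_tendstoI)
  fix e assume "e < (INF n\<in>{1..}. f n / of_nat n)"
  hence "e < f n / of_nat n" if "n \<ge> 1" for n
    using that by (auto intro: less_le_trans INF_lower)
  thus "\<forall>\<^sub>F n in sequentially. e < f n / of_nat n"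
    by (auto simp: eventually_sequentially)
next
  fix e assume "(INF n\<in>{1..}. f n / of_nat n) < e"
  then obtain m where m: "m \<ge> 1" and e: "f m / of_nat m < e" by (auto simp: INF_less_iff)
  define M where "M = (\<Sum>r=1..m. f r)"
  have M: "M < Orderings.top" unfolding M_def by (auto simp: fin)
  have M_ge: "f r \<le> M" if "1 \<le> r" "r \<le> m" for r
    unfolding M_def using that by (intro member_le_sum) auto
  have step: "f (k * m + r) \<le> of_nat k * f m + f r" if "1 \<le> r" for k r
  proof (induction k)
    case (Suc k)
    have "f (Suc k * m + r) \<le> f m + f (k * m + r)"
      using sub[of m "k * m + r"] m that by (simp add: algebra_simps)
    also have "\<dots> \<le> f m + (of_nat k * f m + f r)" using Suc by (rule add_left_mono)
    finally show ?case by (simp add: algebra_simps)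
  qed simp
  have bound: "f n / of_nat n \<le> f m / of_nat m + M / of_nat n" if n: "n \<ge> 1" for n
  proof -
    define k where "k = (n - 1) div m"
    define r where "r = Suc ((n - 1) mod m)"
    have nkr: "n = k * m + r" and r: "1 \<le> r" "r \<le> m"
      using n m by (auto simp: k_def r_def Suc_le_eq)
    obtain x where x: "f m = ennreal x" "x \<ge> 0" using fin[OF m] by (cases "f m") auto
    obtain y where y: "M = ennreal y" "y \<ge> 0" using M by (cases M) auto
    have "f n \<le> of_nat k * f m + M"
      using step[of r k] M_ge[of r] r unfolding nkr by (meson add_left_mono order_trans)
    hence "f n \<le> ennreal (real k * x + y)"
      using x y by (simp add: ennreal_of_nat_eq_real_of_nat ennreal_mult ennreal_plus)
    hence "f n / of_nat n \<le> ennreal (real k * x + y) / of_nat n"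
      by (rule divide_right_mono_ennreal)
    also have "\<dots> = ennreal ((real k * x + y) / real n)"
      using n x y
      by (simp add: ennreal_of_nat_eq_real_of_nat divide_ennreal del: ennreal_plus)
    also have "\<dots> \<le> ennreal (x / real m + y / real n)"
    proof (rule ennreal_leI)
      have "k * m \<le> n" using nkr by simp
      hence "real k * real m \<le> real n" unfolding of_nat_mult[symmetric] by (rule of_nat_mono)
      hence "real k \<le> real n / real m" using m by (simp add: pos_le_divide_eq)
      hence "real k * x \<le> real n / real m * x" using x by (intro mult_right_mono)
      hence "real k * x / real n \<le> real n / real m * x / real n" by (intro divide_right_mono) auto
      also have "\<dots> = x / real m" using n by simp
      finally show "(real k * x + y) / real n \<le> x / real m + y / real n"
        by (simp add: add_divide_distrib)
    qed
    also have "\<dots> = ennreal (x / real m) + ennreal (y / real n)"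
      using x y by (intro ennreal_plus) auto
    also have "ennreal (x / real m) = f m / of_nat m"
      using m x by (simp add: ennreal_of_nat_eq_real_of_nat divide_ennreal)
    also have "ennreal (y / real n) = M / of_nat n"
      using n y by (simp add: ennreal_of_nat_eq_real_of_nat divide_ennreal)
    finally show ?thesis .
  qed
  obtain y where y: "M = ennreal y" "y \<ge> 0" using M by (cases M) auto
  have "(\<lambda>n. ennreal (y / real n)) \<longlonglongrightarrow> ennreal 0"
    by (intro tendsto_ennrealI lim_const_over_n)
  moreover have "\<forall>\<^sub>F n in sequentially. ennreal (y / real n) = M / of_nat n"
    using eventually_gt_at_top[of 0]
    by eventually_elim (use y in \<open>simp add: ennreal_of_nat_eq_real_of_nat divide_ennreal\<close>)
  ultimately have "(\<lambda>n. M / of_nat n) \<longlonglongrightarrow> ennreal 0"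
    by (rule Lim_transform_eventually)
  hence "(\<lambda>n. f m / of_nat m + M / of_nat n) \<longlonglongrightarrow> f m / of_nat m + ennreal 0"
    by (intro tendsto_add tendsto_const)
  hence "\<forall>\<^sub>F n in sequentially. f m / of_nat m + M / of_nat n < e"
    using e by (intro order_tendstoD(2)) auto
  thus "\<forall>\<^sub>F n in sequentially. f n / of_nat n < e"
    using eventually_ge_at_top[of 1]
    by eventually_elim (use bound in \<open>auto intro: le_less_trans\<close>)
qed

text \<open>The limit defining the value of a filtration exists and is an infimum.\<close>

lemma val_filtration_tendsto:
  fixes v :: "'a::comm_ring_1 \<Rightarrow> ennreal"
  assumes v: "v \<in> Val \<mm>" and a: "filtration ring_of_type_algebra a"
  shows "(\<lambda>p. val_ideal v (a p) / of_nat p) \<longlonglongrightarrow> (INF p\<in>{1..}. val_ideal v (a p) / of_nat p)"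
proof -
  let ?f = "\<lambda>p. val_ideal v (a p)"
  have anti: "?f 1 \<le> ?f p" if "p \<ge> 1" for p
    using that
  proof (induction p rule: dec_induct)
    case (step p)
    have "a (p + 1) \<subseteq> a p" using a step by (simp add: filtration_def)
    hence "?f p \<le> ?f (Suc p)" unfolding val_ideal_def by (intro INF_superset_mono) auto
    with step show ?case by simp
  qed simp
  have sub: "?f (m + n) \<le> ?f m + ?f n" if mn: "m \<ge> 1" "n \<ge> 1" for m n
  proof -
    have prod: "x * y \<in> a (m + n)" if "x \<in> a m" "y \<in> a n" for x y
      using a mn ideal_prod.prod[OF that, of ring_of_type_algebra]
      by (auto simp: filtration_def ring_of_type_algebra_def)
    have vm: "v (x * y) = v x + v y" for x y using v by (simp add: Val_def)
    have "ideal (a m) ring_of_type_algebra" "ideal (a n) ring_of_type_algebra"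
      using a mn by (simp_all add: filtration_def)
    hence nonempty: "a m \<noteq> {}" "a n \<noteq> {}"
      by (metis additive_subgroup.zero_closed empty_iff ideal.axioms(1))+
    have "?f (m + n) \<le> v x + v y" if "x \<in> a m" "y \<in> a n" for x y
      unfolding val_ideal_def using prod[OF that] by (metis INF_lower vm)
    hence "?f (m + n) \<le> (INF x\<in>a m. INF y\<in>a n. v y + v x)"
      by (intro INF_greatest) (simp add: add.commute)
    also have "\<dots> = (INF x\<in>a m. ?f n + v x)"
      unfolding val_ideal_def using nonempty by (simp only: INF_add_const_ennreal not_False_eq_True)
    also have "\<dots> = (INF x\<in>a m. v x + ?f n)" by (simp only: add.commute)
    also have "\<dots> = ?f m + ?f n"
      unfolding val_ideal_def using nonempty by (intro INF_add_const_ennreal)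
    finally show ?thesis .
  qed
  show ?thesis
  proof (cases "?f 1 = Orderings.top")
    case True
    hence "?f p = Orderings.top" if "p \<ge> 1" for p using anti[OF that] by (simp add: top_unique)
    hence t: "?f p / of_nat p = Orderings.top" if "p \<ge> 1" for p
      using that by (simp add: ennreal_top_divide)
    hence inf: "(INF p\<in>{1..}. ?f p / of_nat p) = Orderings.top" by simp
    have "\<forall>\<^sub>F p in sequentially. ?f p / of_nat p = Orderings.top"
      using eventually_ge_at_top[of 1] by eventually_elim (rule t)
    thus ?thesis unfolding inf by (rule tendsto_eventually)
  next
    case False
    have fin: "?f p < Orderings.top" if "p \<ge> 1" for p
      using that
    proof (induction p rule: dec_induct)
      case base thus ?case using False by (simp add: less_top)
    next
      case (step p)
      have "?f (p + 1) \<le> ?f p + ?f 1" using step by (intro sub) auto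
      also have "\<dots> < Orderings.top" using step False by (simp add: less_top)
      finally show ?case by simp
    qed
    show ?thesis by (rule ennreal_subadditive_limit[OF sub fin])
  qed
qed

lemma val_filtration_eq_INF:
  assumes "v \<in> Val \<mm>" and "filtration ring_of_type_algebra a"
  shows "val_filtration v a = (INF p\<in>{1..}. val_ideal v (a p) / of_nat p)"
  unfolding val_filtration_def by (rule limI[OF val_filtration_tendsto[OF assms]])

end

theory Submission
  imports Defs
begin

text \<open>
  Let w be the monomial valuation with w(x) = 1 and w(y) = s, where s is the square root of 2, and
  take a_p = {f. w(f) \<open>\<ge>\<close> p} and b_p = I^p with I = (x^3, xy, y^3).  Only the values of v on x and y
  enter: v(a) \<open>\<le>\<close> min(v(x), v(y)/s) because a_p contains x^p and y^k for k \<open>\<ge>\<close> p/s, and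
  v(b) = v(I) = min(3 v(x), v(x) + v(y), 3 v(y)).  For v(x) = 1 and v(y) = t the ratio is thus at most
  min(1, t/s) / min(1 + t, 3), which increases up to t = s and is smaller beyond; it is also
  smaller when v(y) = 1 \<open>\<le>\<close> v(x).  Hence the supremum 1/(1 + s) is attained at w, and every v attaining
  it has v(y)/v(x) = s.  The finite values of a divisorial valuation are integer multiples of one constant,
  so such a v is not divisorial.
\<close>

section \<open>Ideals of the ring of a type\<close>

abbreviation type_ring :: "'a::comm_ring_1 ring" where
  "type_ring \<equiv> ring_of_type_algebra"

lemma type_ring_simps [simp]:
  "carrier type_ring = UNIV" "x \<otimes>\<^bsub>type_ring\<^esub> y = x * y" "x \<oplus>\<^bsub>type_ring\<^esub> y = x + y"
  "\<one>\<^bsub>type_ring\<^esub> = 1" "\<zero>\<^bsub>type_ring\<^esub> = 0"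
  by (simp_all add: ring_of_type_algebra_def)

text \<open>Additive inverses are multiples by -1, so absorption already gives closure under
  negation.\<close>

lemma ideal_type_ringI:
  assumes "0 \<in> I" and "\<And>x y. x \<in> I \<Longrightarrow> y \<in> I \<Longrightarrow> x + y \<in> I" and "\<And>r x. x \<in> I \<Longrightarrow> r * x \<in> I"
  shows "ideal I (type_ring :: 'a::comm_ring_1 ring)"
proof -
  interpret R: cring "type_ring :: 'a ring" by (rule cring_from_type_algebra)
  have minus: "\<ominus>\<^bsub>type_ring\<^esub> x = (-1) * x" for x :: 'a
    by (rule R.minus_equality) simp_all
  show ?thesis
  proof (rule idealI)
    show "subgroup I (add_monoid type_ring)"
      by (rule R.add.subgroupI) (use assms(1,2) assms(3)[of _ "-1"] minus in \<open>auto simp: a_inv_def[symmetric]\<close>)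
    show "a \<otimes>\<^bsub>type_ring\<^esub> x \<in> I" if "a \<in> I" for a x
      unfolding type_ring_simps by (subst mult.commute) (rule assms(3)[OF that])
  qed (use assms(3) R.ring_axioms in simp_all)
qed

lemma
  assumes "ideal I (type_ring :: 'a::comm_ring_1 ring)"
  shows ideal_type_ring_0: "0 \<in> I"
    and ideal_type_ring_add: "x \<in> I \<Longrightarrow> y \<in> I \<Longrightarrow> x + y \<in> I"
    and ideal_type_ring_mult: "x \<in> I \<Longrightarrow> r * x \<in> I"
proof -
  interpret ideal I "type_ring :: 'a ring" by (rule assms)
  show "0 \<in> I" using additive_subgroup.zero_closed[OF is_additive_subgroup] by simp
  show "x \<in> I \<Longrightarrow> y \<in> I \<Longrightarrow> x + y \<in> I"
    using additive_subgroup.a_closed[OF is_additive_subgroup, of x y] by simp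
  show "x \<in> I \<Longrightarrow> r * x \<in> I" using I_l_closed[of x r] by simp
qed

lemma ideal_genideal_type_ring: "ideal (genideal type_ring S) (type_ring :: 'a::comm_ring_1 ring)"
proof -
  interpret R: cring "type_ring :: 'a ring" by (rule cring_from_type_algebra)
  show ?thesis by (rule R.genideal_ideal) simp
qed

lemma genideal_type_ring_incl: "S \<subseteq> genideal type_ring (S :: 'a::comm_ring_1 set)"
  by (auto simp: genideal_def)

text \<open>\<open>ideal_prod\<close> is the inductive closure of the pairwise products under
  addition, so these two cases suffice. K is a plain set, which lets the lemma be applied to
  superlevel sets and colon sets directly.\<close>

lemma ideal_prod_subset:
  assumes "\<And>x y. x \<in> I \<Longrightarrow> y \<in> J \<Longrightarrow> x * y \<in> K" and "\<And>x y. x \<in> K \<Longrightarrow> y \<in> K \<Longrightarrow> x + y \<in> K"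
  shows "ideal_prod (type_ring :: 'a::comm_ring_1 ring) I J \<subseteq> K"
proof
  show "z \<in> K" if "z \<in> ideal_prod type_ring I J" for z
    using that by induction (use assms in auto)
qed

lemma ideal_prod_mono:
  assumes "I \<subseteq> I'" "J \<subseteq> J'"
  shows "ideal_prod (type_ring :: 'a::comm_ring_1 ring) I J \<subseteq> ideal_prod type_ring I' J'"
proof (rule ideal_prod_subset)
  show "x * y \<in> ideal_prod type_ring I' J'" if "x \<in> I" "y \<in> J" for x y
    using ideal_prod.prod[of x I' y J' type_ring] that assms by auto
  show "x + y \<in> ideal_prod type_ring I' J'"
    if "x \<in> ideal_prod type_ring I' J'" "y \<in> ideal_prod type_ring I' J'" for x y :: 'a
    using ideal_prod.sum[OF that] by simp
qed

lemma comm_monoid_ideals_set: "comm_monoid (ideals_set (type_ring :: 'a::comm_ring_1 ring))"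
  by (rule cring.ideals_set_is_comm_monoid[OF cring_from_type_algebra])

lemma ideal_power_0: "ideal_power (type_ring :: 'a::comm_ring_1 ring) I 0 = UNIV"
  by (simp add: ideal_power_def nat_pow_def ideals_set_def)

lemma ideal_power_Suc:
  "ideal_power R I (Suc n) = ideal_prod R (ideal_power R I n) I"
  by (simp add: ideal_power_def nat_pow_def ideals_set_def)

lemma
  assumes I: "ideal I (type_ring :: 'a::comm_ring_1 ring)"
  shows ideal_ideal_power: "ideal (ideal_power type_ring I n) type_ring"
    and ideal_power_add:
      "ideal_power type_ring I (m + n) = ideal_prod type_ring (ideal_power type_ring I m) (ideal_power type_ring I n)"
    and ideal_power_mult:
      "ideal_power type_ring I (m * n) = ideal_power type_ring (ideal_power type_ring I m) n"
    and ideal_power_1: "ideal_power type_ring I 1 = I"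
proof -
  let ?M = "ideals_set (type_ring :: 'a ring)"
  interpret M: comm_monoid ?M by (rule comm_monoid_ideals_set)
  have M: "carrier ?M = {I. ideal I type_ring}" "monoid.mult ?M = ideal_prod type_ring"
    by (simp_all add: ideals_set_def)
  have I': "I \<in> carrier ?M" using I by (simp add: M)
  show "ideal (ideal_power type_ring I n) type_ring"
    using M.nat_pow_closed[OF I', of n] by (simp add: M ideal_power_def)
  show "ideal_power type_ring I (m + n) = ideal_prod type_ring (ideal_power type_ring I m) (ideal_power type_ring I n)"
    using M.nat_pow_mult[OF I', of m n] by (simp add: M ideal_power_def)
  show "ideal_power type_ring I (m * n) = ideal_power type_ring (ideal_power type_ring I m) n"
    using M.nat_pow_pow[OF I', of m n] by (simp add: ideal_power_def)
  show "ideal_power type_ring I 1 = I"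
    using M.nat_pow_eone[OF I'] by (simp add: ideal_power_def)
qed

lemma ideal_power_mono:
  "I \<subseteq> J \<Longrightarrow> ideal_power (type_ring :: 'a::comm_ring_1 ring) I n \<subseteq> ideal_power type_ring J n"
  by (induction n) (simp_all add: ideal_power_0 ideal_power_Suc ideal_prod_mono)

lemma ideal_power_Suc_subset:
  assumes "ideal I (type_ring :: 'a::comm_ring_1 ring)"
  shows "ideal_power type_ring I (Suc n) \<subseteq> ideal_power type_ring I n"
  unfolding ideal_power_Suc
proof (rule ideal_prod_subset)
  show "x * y \<in> ideal_power type_ring I n" if "x \<in> ideal_power type_ring I n" for x y
    using ideal_type_ring_mult[OF ideal_ideal_power[OF assms] that] by (subst mult.commute)
qed (rule ideal_type_ring_add[OF ideal_ideal_power[OF assms]])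

lemma ideal_power_le_subset:
  assumes "ideal I (type_ring :: 'a::comm_ring_1 ring)" and "m \<le> n"
  shows "ideal_power type_ring I n \<subseteq> ideal_power type_ring I m"
  using assms(2) by (induction n rule: dec_induct) (use ideal_power_Suc_subset[OF assms(1)] in blast)+

section \<open>Semivaluations\<close>

lemma
  assumes "v \<in> Val M"
  shows Val_0: "v 0 = \<infinity>" and Val_mult: "v (x * y) = v x + v y"
    and Val_add: "min (v x) (v y) \<le> v (x + y)" and Val_1: "v 1 = 0"
  using assms dvd_refl[of 1] unfolding Val_def by blast+

lemma Val_power: "v \<in> Val M \<Longrightarrow> v (x ^ n) = of_nat n * v x"
  by (induction n) (simp_all add: Val_1 Val_mult distrib_right)

lemma ideal_Val_ge:
  fixes v :: "'a::comm_ring_1 \<Rightarrow> ennreal"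
  assumes "v \<in> Val M"
  shows "ideal {x. c \<le> v x} type_ring"
proof (rule ideal_type_ringI)
  show "0 \<in> {x. c \<le> v x}" using assms by (simp add: Val_0)
  show "x + y \<in> {x. c \<le> v x}" if "x \<in> {x. c \<le> v x}" "y \<in> {x. c \<le> v x}" for x y
    using that by (auto intro: order_trans[OF _ Val_add[OF assms]])
  show "r * x \<in> {x. c \<le> v x}" if "x \<in> {x. c \<le> v x}" for r x
    using that by (simp add: Val_mult[OF assms] add_increasing)
qed

text \<open>Each further factor from J contributes at least \<open>val_ideal v J\<close>, and
  superlevel sets of v absorb the sums. This bounds v from below on powers of the three-vertex ideal
  and also puts powers of the maximal ideal inside the members of a.\<close>

lemma Val_ideal_power_ge:
  fixes v :: "'a::comm_ring_1 \<Rightarrow> ennreal"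
  assumes v: "v \<in> Val M" and "x \<in> ideal_power type_ring J n"
  shows "of_nat n * val_ideal v J \<le> v x"
proof -
  have "ideal_power type_ring J n \<subseteq> {x. of_nat n * val_ideal v J \<le> v x}"
  proof (induction n)
    case (Suc n)
    show ?case unfolding ideal_power_Suc
    proof (rule ideal_prod_subset)
      show "x * y \<in> {x. of_nat (Suc n) * val_ideal v J \<le> v x}"
        if "x \<in> ideal_power type_ring J n" "y \<in> J" for x y
      proof -
        have "val_ideal v J \<le> v y" unfolding val_ideal_def using that(2) by (rule INF_lower)
        moreover have "of_nat n * val_ideal v J \<le> v x" using Suc that(1) by blast
        ultimately show ?thesis
          by (simp add: Val_mult[OF v] distrib_right add_mono add.commute[of "val_ideal v J"])
      qed
    qed (rule ideal_type_ring_add[OF ideal_Val_ge[OF v]])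
  qed simp
  with assms(2) show ?thesis by blast
qed

lemma filtration_Val_ge:
  fixes v :: "'a::comm_ring_1 \<Rightarrow> ennreal"
  assumes v: "v \<in> Val M"
  shows "filtration type_ring (\<lambda>p. {x. of_nat p \<le> v x})"
  unfolding filtration_def
proof (intro conjI allI impI)
  fix p p' :: nat
  show "ideal {x. of_nat p \<le> v x} type_ring" by (rule ideal_Val_ge[OF v])
  show "{x. of_nat p \<le> v x} \<noteq> carrier type_ring" if "1 \<le> p"
    using that Val_1[OF v] by (auto simp: set_eq_iff intro!: exI[of _ 1])
  show "ideal_prod type_ring {x. of_nat p \<le> v x} {x. of_nat p' \<le> v x} \<subseteq> {x. of_nat (p + p') \<le> v x}"
    by (rule ideal_prod_subset, simp add: Val_mult[OF v] add_mono, rule ideal_type_ring_add[OF ideal_Val_ge[OF v]])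
  have "(of_nat p :: ennreal) \<le> of_nat (p + 1)" by (rule of_nat_mono) simp
  thus "{x. of_nat (p + 1) \<le> v x} \<subseteq> {x. of_nat p \<le> v x}"
    using order_trans by fast
qed

text \<open>Properness of the powers comes from containment in the first power, which is I
  itself.\<close>

lemma filtration_ideal_power:
  assumes I: "ideal I (type_ring :: 'a::comm_ring_1 ring)" and proper: "I \<noteq> UNIV"
  shows "filtration type_ring (ideal_power type_ring I)"
  unfolding filtration_def
proof (intro conjI allI impI)
  fix p p' :: nat
  show "ideal (ideal_power type_ring I p) type_ring" by (rule ideal_ideal_power[OF I])
  show "ideal_power type_ring I p \<noteq> carrier type_ring" if "1 \<le> p"
    using ideal_power_le_subset[OF I that] proper ideal_power_1[OF I] by auto
  show "ideal_prod type_ring (ideal_power type_ring I p) (ideal_power type_ring I p')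
      \<subseteq> ideal_power type_ring I (p + p')"
    by (simp add: ideal_power_add[OF I])
  show "ideal_power type_ring I (p + 1) \<subseteq> ideal_power type_ring I p"
    using ideal_power_Suc_subset[OF I] by simp
qed

text \<open>The limit is an infimum over p, so one element of one member is enough for an upper
  bound.\<close>

lemma val_filtration_le:
  fixes v :: "'a::comm_ring_1 \<Rightarrow> ennreal"
  assumes "v \<in> Val M" "filtration type_ring a" "p \<ge> 1" "x \<in> a p"
  shows "val_filtration v a \<le> v x / of_nat p"
proof -
  have "val_filtration v a \<le> val_ideal v (a p) / of_nat p"
    unfolding val_filtration_eq_INF[OF assms(1,2)] using assms(3) by (intro INF_lower) simp
  also have "\<dots> \<le> v x / of_nat p"
    unfolding val_ideal_def using assms(4) by (intro divide_right_mono_ennreal INF_lower)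
  finally show ?thesis .
qed

lemma val_filtration_ge:
  fixes v :: "'a::comm_ring_1 \<Rightarrow> ennreal"
  assumes "v \<in> Val M" "filtration type_ring a"
    and "\<And>p x. p \<ge> 1 \<Longrightarrow> x \<in> a p \<Longrightarrow> of_nat p * c \<le> v x"
  shows "c \<le> val_filtration v a"
  unfolding val_filtration_eq_INF[OF assms(1,2)] val_ideal_def
proof (rule INF_greatest)
  fix p :: nat assume "p \<in> {1..}"
  hence p: "p \<ge> 1" by simp
  have "c = of_nat p * c / of_nat p"
    using p by (simp add: ennreal_mult_divide_eq mult.commute)
  also have "\<dots> \<le> (INF x\<in>a p. v x) / of_nat p"
    by (intro divide_right_mono_ennreal INF_greatest assms(3) p)
  finally show "c \<le> (INF x\<in>a p. v x) / of_nat p" .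
qed

section \<open>Integrality of the finite values of divisorial valuations\<close>

text \<open>A finite nonempty index set has a maximum, the empty one gives 0, and an infinite one is
  unbounded. Since \<open>ord_along\<close> is such a supremum, its finite values are natural
  numbers.\<close>

lemma SUP_of_nat_ennreal_cases:
  "(SUP n\<in>S. of_nat n :: ennreal) = \<infinity> \<or> (\<exists>k. (SUP n\<in>S. of_nat n :: ennreal) = of_nat k)"
proof (cases "finite S")
  case True
  show ?thesis
  proof (cases "S = {}")
    case False
    have "Max S \<in> S" using True False by simp
    hence "(SUP n\<in>S. of_nat n :: ennreal) = of_nat (Max S)"
      using True by (intro antisym SUP_least SUP_upper) auto
    thus ?thesis by blast
  qed (auto intro: exI[of _ 0] simp: bot_ennreal)
next
  case False
  have "(SUP n. of_nat n :: ennreal) \<le> (SUP n\<in>S. of_nat n)"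
  proof (rule SUP_least)
    fix k :: nat
    obtain n where "n \<in> S" "k < n" using False by (auto simp: infinite_nat_iff_unbounded)
    thus "(of_nat k :: ennreal) \<le> (SUP n\<in>S. of_nat n)" by (intro SUP_upper2[of n]) auto
  qed
  thus ?thesis by (simp add: ennreal_SUP_of_nat_eq_top top_unique)
qed

text \<open>Both values are natural multiples of the same scaling constant c, which cancels in the
  quotient.\<close>

lemma divisorial_values_commensurable:
  assumes "divisorial v" and vx: "v x = ennreal r" "0 < r" and vy: "v y = ennreal t" "0 < t"
  shows "t / r \<in> \<rat>"
proof -
  obtain B c where c: "c > 0" and v: "\<And>f. v f = ennreal c * ord_along B f"
    using assms(1) unfolding divisorial_def by blast
  have val: "\<exists>k. u = c * of_nat k" if "v z = ennreal u" "0 < u" for z u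
  proof -
    have ne: "ord_along B z \<noteq> \<infinity>"
    proof
      assume "ord_along B z = \<infinity>"
      hence "v z = Orderings.top" using c by (simp add: v ennreal_mult_top)
      thus False using that by simp
    qed
    then obtain k where "ord_along B z = of_nat k"
      using SUP_of_nat_ennreal_cases unfolding ord_along_def by metis
    hence "ennreal u = ennreal (c * real k)"
      using v[of z] that c by (simp add: ennreal_mult ennreal_of_nat_eq_real_of_nat)
    thus ?thesis using that c by auto
  qed
  obtain k l where "r = c * of_nat k" "t = c * of_nat l" using val vx vy by metis
  hence "t / r = of_nat l / of_nat k" using c by simp
  thus ?thesis by simp
qed

section \<open>Monomial valuations\<close>

text \<open>Order of vanishing with weight 1 on x and s on y. The infimum of the empty set in
  \<open>ennreal\<close> is infinity, which gives the value required at 0.\<close>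

definition monomial_valuation :: "real \<Rightarrow> power_series2 \<Rightarrow> ennreal" where
  "monomial_valuation s f = (INF (i, j)\<in>{(i, j). f $ j $ i \<noteq> 0}. ennreal (real i + s * real j))"

lemma le_monomial_valuation_iff:
  "c \<le> monomial_valuation s f \<longleftrightarrow> (\<forall>i j. f $ j $ i \<noteq> 0 \<longrightarrow> c \<le> ennreal (real i + s * real j))"
  by (auto simp: monomial_valuation_def le_INF_iff)

lemma monomial_valuation_le:
  "f $ j $ i \<noteq> 0 \<Longrightarrow> monomial_valuation s f \<le> ennreal (real i + s * real j)"
  using le_monomial_valuation_iff by blast

lemma monomial_valuation_0: "monomial_valuation s 0 = \<infinity>"
  by (simp add: monomial_valuation_def)

text \<open>Since both weights are positive, only finitely many monomials weigh at most as much as a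
  chosen one in the support. A minimum over this finite set T is a minimum over the whole
  support.\<close>

lemma monomial_valuation_attained:
  assumes "s > 0" "f \<noteq> 0"
  obtains i j where "f $ j $ i \<noteq> 0" "monomial_valuation s f = ennreal (real i + s * real j)"
proof -
  define w where "w = (\<lambda>(i, j). real i + s * real j)"
  define S where "S = {(i, j). f $ j $ i \<noteq> 0}"
  obtain e where e: "e \<in> S"
    using assms(2) by (auto simp: S_def fps_eq_iff)
  define T where "T = {p \<in> S. w p \<le> w e}"
  have "T \<subseteq> {..nat \<lceil>w e\<rceil>} \<times> {..nat \<lceil>w e / s\<rceil>}"
  proof
    fix q assume "q \<in> T"
    then obtain i j where q: "q = (i, j)" and le: "real i + s * real j \<le> w e"
      by (cases q) (auto simp: T_def w_def)
    have "0 \<le> s * real j" using assms by simp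
    hence "real i \<le> w e" using le by linarith
    moreover have "real j \<le> w e / s" using le assms by (simp add: field_simps)
    ultimately have "i \<le> nat \<lceil>w e\<rceil>" "j \<le> nat \<lceil>w e / s\<rceil>" by linarith+
    thus "q \<in> {..nat \<lceil>w e\<rceil>} \<times> {..nat \<lceil>w e / s\<rceil>}" by (simp add: q)
  qed
  hence "finite T" by (rule finite_subset) simp
  moreover have "e \<in> T" using e by (simp add: T_def)
  ultimately obtain p where p: "p \<in> T" "\<And>q. q \<in> T \<Longrightarrow> w p \<le> w q"
    using arg_min_if_finite[of T w] by (metis empty_iff not_le)
  have pS: "p \<in> S" and pe: "w p \<le> w e" using p(1) unfolding T_def by blast+
  have min: "w p \<le> w q" if "q \<in> S" for q
  proof (cases "w q \<le> w e")
    case True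
    with that have "q \<in> T" by (simp add: T_def)
    thus ?thesis by (rule p(2))
  qed (use pe in simp)
  have "monomial_valuation s f = (INF q\<in>S. ennreal (w q))"
    by (simp add: monomial_valuation_def S_def w_def case_prod_beta')
  also have "\<dots> = ennreal (w p)"
    using pS min by (intro antisym INF_lower INF_greatest ennreal_leI)
  finally have "monomial_valuation s f = ennreal (w p)" .
  with pS that show ?thesis by (cases p) (auto simp: S_def w_def)
qed

lemma fps_fps_mult_nth:
  fixes f g :: "'a::comm_semiring_1 fps fps"
  shows "(f * g) $ j $ i = (\<Sum>(l, k)\<in>{0..j} \<times> {0..i}. f $ l $ k * g $ (j - l) $ (i - k))"
  by (simp add: fps_mult_nth fps_sum_nth sum.cartesian_product)

lemma irrational_weight_inj:
  assumes "s \<notin> \<rat>" and eq: "real i + s * real j = real k + s * real l"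
  shows "i = k \<and> j = l"
proof -
  have "j = l"
  proof (rule ccontr)
    assume "j \<noteq> l"
    hence "s = (real k - real i) / (real j - real l)"
      using eq by (simp add: field_simps)
    thus False using assms(1) by simp
  qed
  with eq show ?thesis by simp
qed

text \<open>Irrationality makes the weights of distinct monomials distinct, so the lowest terms of
  two factors cannot cancel.\<close>

lemma monomial_valuation_mult:
  assumes s: "s > 0" "s \<notin> \<rat>"
  shows "monomial_valuation s (f * g) = monomial_valuation s f + monomial_valuation s g"
proof (cases "f = 0 \<or> g = 0")
  case True thus ?thesis by (auto simp: monomial_valuation_0)
next
  case False
  obtain i j where f: "f $ j $ i \<noteq> 0" "monomial_valuation s f = ennreal (real i + s * real j)"
    using monomial_valuation_attained[OF s(1)] False by metis
  obtain k l where g: "g $ l $ k \<noteq> 0" "monomial_valuation s g = ennreal (real k + s * real l)"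
    using monomial_valuation_attained[OF s(1)] False by metis
  have f_min: "real i + s * real j \<le> real i' + s * real j'" if "f $ j' $ i' \<noteq> 0" for i' j'
    using monomial_valuation_le[OF that, of s] f s by (simp add: ennreal_le_iff del: ennreal_plus)
  have g_min: "real k + s * real l \<le> real k' + s * real l'" if "g $ l' $ k' \<noteq> 0" for k' l'
    using monomial_valuation_le[OF that, of s] g s by (simp add: ennreal_le_iff del: ennreal_plus)
  have sum: "monomial_valuation s f + monomial_valuation s g
      = ennreal (real i + s * real j + (real k + s * real l))"
    using s f g by (simp add: ennreal_plus)
  show ?thesis
  proof (rule antisym)
    \<comment> \<open>The coefficient at the product of the two lowest monomials reduces to a single
      nonzero summand.\<close>
    have "(f * g) $ (j + l) $ (i + k)
      = (\<Sum>(l', k')\<in>{(j, i)}. f $ l' $ k' * g $ (j + l - l') $ (i + k - k'))"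
      unfolding fps_fps_mult_nth
    proof (intro sum.mono_neutral_right ballI)
      fix q assume q: "q \<in> {0..j + l} \<times> {0..i + k} - {(j, i)}"
      obtain j' i' where q': "q = (j', i')" by fastforce
      have "f $ j' $ i' * g $ (j + l - j') $ (i + k - i') = 0"
      proof (rule ccontr)
        assume "f $ j' $ i' * g $ (j + l - j') $ (i + k - i') \<noteq> 0"
        hence "real i + s * real j \<le> real i' + s * real j'"
          and "real k + s * real l \<le> real (i + k - i') + s * real (j + l - j')"
          using f_min g_min by auto
        \<comment> \<open>Both factors have at least the minimal weight while the total weight is
          the sum of the minima, so both inequalities are equalities.\<close>
        hence "real i' + s * real j' = real i + s * real j"
          using q q' by (simp add: of_nat_diff algebra_simps)
        hence "i' = i \<and> j' = j" using irrational_weight_inj[OF s(2)] by blast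
        thus False using q q' by simp
      qed
      thus "(case q of (l', k') \<Rightarrow> f $ l' $ k' * g $ (j + l - l') $ (i + k - k')) = 0"
        by (simp add: q')
    qed auto
    hence "(f * g) $ (j + l) $ (i + k) \<noteq> 0" using f g by simp
    from monomial_valuation_le[OF this, of s]
    show "monomial_valuation s (f * g) \<le> monomial_valuation s f + monomial_valuation s g"
      unfolding sum by (simp add: algebra_simps del: ennreal_plus)
    show "monomial_valuation s f + monomial_valuation s g \<le> monomial_valuation s (f * g)"
      unfolding sum le_monomial_valuation_iff
    proof (intro allI impI ennreal_leI)
      fix a b assume "(f * g) $ b $ a \<noteq> 0"
      then obtain j' i' where le: "j' \<le> b" "i' \<le> a"
        and "f $ j' $ i' \<noteq> 0" "g $ (b - j') $ (a - i') \<noteq> 0"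
        unfolding fps_fps_mult_nth by (force elim: sum.not_neutral_contains_not_neutral)
      from f_min[OF this(3)] g_min[OF this(4)]
      show "real i + s * real j + (real k + s * real l) \<le> real a + s * real b"
        using le by (simp add: of_nat_diff algebra_simps)
    qed
  qed
qed

lemma monomial_valuation_add:
  "min (monomial_valuation s f) (monomial_valuation s g) \<le> monomial_valuation s (f + g)"
  unfolding le_monomial_valuation_iff
proof (intro allI impI)
  fix i j assume "(f + g) $ j $ i \<noteq> 0"
  hence "f $ j $ i \<noteq> 0 \<or> g $ j $ i \<noteq> 0" by auto
  thus "min (monomial_valuation s f) (monomial_valuation s g) \<le> ennreal (real i + s * real j)"
    by (auto intro: min.coboundedI1 min.coboundedI2 monomial_valuation_le)
qed

section \<open>The variables, the maximal ideal and its powers\<close>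

lemma var_x_nth: "var_x $ j $ i = (if j = 0 \<and> i = 1 then 1 else 0)"
  by (simp add: var_x_def)

lemma var_y_nth: "var_y $ j $ i = (if j = 1 \<and> i = 0 then 1 else 0)"
  by (simp add: var_y_def fps_X_nth)

lemma monomial_valuation_var_x: "monomial_valuation s var_x = 1"
proof (rule antisym)
  show "monomial_valuation s var_x \<le> 1"
    using monomial_valuation_le[of var_x 0 1 s] by (simp add: var_x_nth)
qed (auto simp: le_monomial_valuation_iff var_x_nth)

lemma monomial_valuation_var_y: "monomial_valuation s var_y = ennreal s"
proof (rule antisym)
  show "monomial_valuation s var_y \<le> ennreal s"
    using monomial_valuation_le[of var_y 1 0 s] by (simp add: var_y_nth)
qed (auto simp: le_monomial_valuation_iff var_y_nth)

lemma power_series_ring2_eq: "power_series_ring2 = type_ring"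
  by (simp add: power_series_ring2_def)

lemma ideal_max_ideal2: "ideal max_ideal2 type_ring"
  by (simp add: max_ideal2_def power_series_ring2_eq ideal_genideal_type_ring)

lemma var_in_max_ideal2: "var_x \<in> max_ideal2" "var_y \<in> max_ideal2"
  using genideal_type_ring_incl[of "{var_x, var_y}"]
  by (auto simp: max_ideal2_def power_series_ring2_eq)

lemma max_ideal2E:
  assumes "f \<in> max_ideal2"
  obtains g h where "f = var_x * g + var_y * h"
proof -
  interpret R: cring "type_ring :: power_series2 ring" by (rule cring_from_type_algebra)
  let ?K = "{var_x * g + var_y * h | g h. True}"
  have "ideal ?K type_ring"
  proof (rule ideal_type_ringI)
    show "0 \<in> ?K" by (auto intro: exI[of _ 0])
    show "f + g \<in> ?K" if "f \<in> ?K" "g \<in> ?K" for f g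
    proof -
      from that obtain a b c d where "f = var_x * a + var_y * b" "g = var_x * c + var_y * d" by auto
      hence "f + g = var_x * (a + c) + var_y * (b + d)" by (simp add: algebra_simps)
      thus ?thesis by blast
    qed
    show "r * f \<in> ?K" if "f \<in> ?K" for r f
    proof -
      from that obtain a b where "f = var_x * a + var_y * b" by auto
      hence "r * f = var_x * (r * a) + var_y * (r * b)" by (simp add: algebra_simps)
      thus ?thesis by blast
    qed
  qed
  moreover have "var_x = var_x * 1 + var_y * 0" "var_y = var_x * 0 + var_y * 1" by simp_all
  hence "{var_x, var_y} \<subseteq> ?K" by blast
  ultimately have "max_ideal2 \<subseteq> ?K"
    unfolding max_ideal2_def power_series_ring2_eq by (rule R.genideal_minimal)
  with assms that show ?thesis by blast
qed

lemma val_max_ideal2: "v \<in> Val M \<Longrightarrow> val_ideal v max_ideal2 = min (v var_x) (v var_y)"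
  using val_ideal_genideal[of v M "{var_x, var_y}"]
  by (simp add: max_ideal2_def power_series_ring2_eq)

lemma monomial_valuation_Val:
  assumes s: "s \<ge> 1" "s \<notin> \<rat>"
  shows "monomial_valuation s \<in> Val_normalized max_ideal2 max_ideal2"
proof -
  let ?v = "monomial_valuation s"
  have mult: "?v (f * g) = ?v f + ?v g" for f g using s by (intro monomial_valuation_mult) auto
  have one: "?v 1 = 0"
    using monomial_valuation_le[of 1 0 0 s] by simp
  have unit: "?v f = 0" if "f dvd 1" for f
    using that mult one by (metis add_eq_0_iff_both_eq_0 dvdE zero_le)
  \<comment> \<open>With the empty set the positivity condition is vacuous. This suffices to compute
    the value 1 on the maximal ideal, from which positivity there is then deduced.\<close>
  have "?v \<in> Val {}"
    using monomial_valuation_0 mult monomial_valuation_add unit by (auto simp: Val_def)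
  hence m: "val_ideal ?v max_ideal2 = 1"
    using val_max_ideal2 s by (simp add: monomial_valuation_var_x monomial_valuation_var_y min_def)
  have "?v f > 0" if "f \<in> max_ideal2" for f
  proof -
    have "1 \<le> ?v f" using m that by (metis INF_lower val_ideal_def)
    thus ?thesis by (rule less_le_trans[rotated]) simp
  qed
  with m \<open>?v \<in> Val {}\<close> show ?thesis by (auto simp: Val_def Val_normalized_def)
qed

text \<open>Induction on n: the part of f free of y has no constant term, hence is divisible by x,
  and the rest is divisible by y. Both quotients g and h have all their monomials of degree at least
  n.\<close>

lemma in_max_ideal2_powerI:
  assumes "\<And>i j. f $ j $ i \<noteq> 0 \<Longrightarrow> n \<le> i + j"
  shows "f \<in> ideal_power type_ring max_ideal2 n"
  using assms
proof (induction n arbitrary: f)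
  case (Suc n)
  define g where "g = fps_const (fps_shift 1 (f $ 0))"
  define h where "h = fps_shift 1 f"
  have "f $ 0 $ 0 = 0" using Suc.prems[of 0 0] by auto
  hence "f $ 0 = fps_shift 1 (f $ 0) * fps_X"
    by (auto simp: fps_eq_iff)
  hence f: "f = g * var_x + h * var_y"
    by (auto simp: fps_eq_iff g_def h_def var_x_def var_y_def)
  have "g \<in> ideal_power type_ring max_ideal2 n" "h \<in> ideal_power type_ring max_ideal2 n"
    using Suc.prems by (fastforce intro!: Suc.IH simp: g_def h_def split: if_splits)+
  hence "g * var_x \<in> ideal_power type_ring max_ideal2 (Suc n)"
    "h * var_y \<in> ideal_power type_ring max_ideal2 (Suc n)"
    unfolding ideal_power_Suc
    using ideal_prod.prod[OF _ var_in_max_ideal2(1), of _ _ type_ring]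
      ideal_prod.prod[OF _ var_in_max_ideal2(2), of _ _ type_ring] by simp_all
  thus ?case
    using ideal_type_ring_add[OF ideal_ideal_power[OF ideal_max_ideal2]] f by metis
qed (simp add: ideal_power_0)

section \<open>The ideal (x^3, xy, y^3)\<close>

text \<open>The exponents (3,0), (1,1), (0,3) are the vertices of its Newton polygon. For weights
  (1, t) with 1 \<le> t \<le> 2 the middle one gives the minimum 1 + t, and this range contains the
  square root of 2; the cubes make the ideal contain a power of the maximal ideal.\<close>

definition three_vertex_ideal :: "power_series2 set" where
  "three_vertex_ideal = genideal type_ring {var_x ^ 3, var_x * var_y, var_y ^ 3}"

lemma ideal_three_vertex_ideal: "ideal three_vertex_ideal type_ring"
  by (simp add: three_vertex_ideal_def ideal_genideal_type_ring)

lemma three_vertex_ideal_gens: "var_x ^ 3 \<in> three_vertex_ideal" "var_x * var_y \<in> three_vertex_ideal" "var_y ^ 3 \<in> three_vertex_ideal"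
  using genideal_type_ring_incl[of "{var_x ^ 3, var_x * var_y, var_y ^ 3}"]
  by (auto simp: three_vertex_ideal_def)

lemma three_vertex_ideal_subset: "three_vertex_ideal \<subseteq> max_ideal2"
proof -
  interpret R: cring "type_ring :: power_series2 ring" by (rule cring_from_type_algebra)
  have "r * var_x \<in> max_ideal2" "r * var_y \<in> max_ideal2" for r
    using ideal_type_ring_mult[OF ideal_max_ideal2] var_in_max_ideal2 by auto
  hence "{var_x ^ 3, var_x * var_y, var_y ^ 3} \<subseteq> max_ideal2"
    by (simp add: numeral_3_eq_3 power_Suc2 del: power_Suc)
  thus ?thesis
    unfolding three_vertex_ideal_def by (rule R.genideal_minimal[OF ideal_max_ideal2])
qed

text \<open>Every mixed cubic monomial is divisible by x y, so the expansion is grouped as a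
  combination of the three generators.\<close>

lemma product_of_three_linear_forms:
  fixes x y :: "'a::comm_ring_1"
  shows "(x * a + y * b) * (x * c + y * d) * (x * e + y * f) = (a * c * e) * x ^ 3 + (b * d * f) * y ^ 3
    + (x * (a * c * f + a * d * e + b * c * e) + y * (a * d * f + b * c * f + b * d * e)) * (x * y)"
  by (simp add: algebra_simps power3_eq_cube)

lemma max_ideal2_cubed_subset: "ideal_power type_ring max_ideal2 3 \<subseteq> three_vertex_ideal"
proof -
  \<comment> \<open>The colon set of the three-vertex ideal by the maximal ideal. It is closed under
    addition, so the claim passes from products of two elements to the whole square of the maximal
    ideal before the third factor is treated.\<close>
  let ?K = "{f. \<forall>g\<in>max_ideal2. f * g \<in> three_vertex_ideal}"
  note add = ideal_type_ring_add[OF ideal_three_vertex_ideal]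
  note mult = ideal_type_ring_mult[OF ideal_three_vertex_ideal]
  have "p * q * r \<in> three_vertex_ideal" if m: "p \<in> max_ideal2" "q \<in> max_ideal2" "r \<in> max_ideal2" for p q r
  proof -
    obtain a b where p: "p = var_x * a + var_y * b" using max_ideal2E[OF m(1)] by blast
    obtain c d where q: "q = var_x * c + var_y * d" using max_ideal2E[OF m(2)] by blast
    obtain e f where r: "r = var_x * e + var_y * f" using max_ideal2E[OF m(3)] by blast
    show ?thesis
      unfolding p q r
      by (subst product_of_three_linear_forms,
          rule add[OF add[OF mult[OF three_vertex_ideal_gens(1)] mult[OF three_vertex_ideal_gens(3)]]
            mult[OF three_vertex_ideal_gens(2)]])
  qed
  hence "p * q \<in> ?K" if "p \<in> max_ideal2" "q \<in> max_ideal2" for p q using that by blast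
  moreover have "p + q \<in> ?K" if "p \<in> ?K" "q \<in> ?K" for p q
    using that add by (simp add: distrib_right)
  ultimately have "ideal_prod type_ring max_ideal2 max_ideal2 \<subseteq> ?K" by (rule ideal_prod_subset)
  hence "p * q \<in> three_vertex_ideal" if "p \<in> ideal_prod type_ring max_ideal2 max_ideal2" "q \<in> max_ideal2" for p q
    using that by blast
  hence "ideal_prod type_ring (ideal_prod type_ring max_ideal2 max_ideal2) max_ideal2 \<subseteq> three_vertex_ideal"
    using add by (rule ideal_prod_subset)
  moreover have "ideal_power type_ring max_ideal2 3
      = ideal_prod type_ring (ideal_prod type_ring max_ideal2 max_ideal2) max_ideal2"
    using ideal_power_Suc[of type_ring max_ideal2] ideal_power_1[OF ideal_max_ideal2]
    by (simp add: numeral_3_eq_3)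
  ultimately show ?thesis by simp
qed

lemma val_three_vertex_ideal:
  assumes "v \<in> Val M"
  shows "val_ideal v three_vertex_ideal = min (3 * v var_x) (min (v var_x + v var_y) (3 * v var_y))"
  using val_ideal_genideal[OF assms, of "{var_x ^ 3, var_x * var_y, var_y ^ 3}"]
  by (simp add: three_vertex_ideal_def Val_power[OF assms] Val_mult[OF assms])

section \<open>The optimization problem\<close>

lemma ennreal_inverse_antimono: "a \<le> b \<Longrightarrow> inverse b \<le> inverse (a :: ennreal)"
  by (cases "a = 0"; cases a; cases b) (auto simp: inverse_ennreal top_unique ennreal_le_iff intro!: ennreal_leI le_imp_inverse_le split: if_splits)

lemma ennreal_divide_le:
  assumes "A \<le> ennreal a" "ennreal b \<le> B" "0 \<le> a" "0 < b"
  shows "A / B \<le> ennreal (a / b)"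
proof -
  have "A / B \<le> ennreal a / ennreal b"
    unfolding divide_ennreal_def using assms by (intro mult_mono ennreal_inverse_antimono) auto
  thus ?thesis using assms by (simp add: divide_ennreal)
qed

text \<open>Here \<alpha>, \<beta>, A, B stand for v(x), v(y), v(a), v(b). Strictness away from a
  single pair (\<alpha>, \<beta>) yields both the supremum and the values on x and y of every
  maximizer.\<close>

lemma ratio_bound:
  fixes A B \<alpha> \<beta> :: ennreal
  assumes s: "1 < s" "s < 2" and "min \<alpha> \<beta> = 1" and A: "A \<le> \<alpha>" "ennreal s * A \<le> \<beta>"
    and B: "min (3 * \<alpha>) (min (\<alpha> + \<beta>) (3 * \<beta>)) \<le> B"
  shows "A / B < ennreal (1 / (1 + s)) \<or> (\<alpha> = 1 \<and> \<beta> = ennreal s \<and> A / B \<le> ennreal (1 / (1 + s)))"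
proof -
  have strict: "A / B < ennreal (1 / (1 + s))"
    if "A \<le> ennreal a" "ennreal b \<le> B" "0 \<le> a" "0 < b" "a * (1 + s) < b" for a b
  proof -
    have "a / b < 1 / (1 + s)" using that s by (simp add: field_simps)
    thus ?thesis using ennreal_divide_le[OF that(1-4)] s
      by (auto intro!: le_less_trans[OF _ ennreal_lessI])
  qed
  have As: "A \<le> ennreal (t / s)" if "\<beta> = ennreal t" "0 \<le> t" for t
  proof -
    have "A \<noteq> \<infinity>" using A(2) that s by (auto simp: ennreal_mult_top top_unique)
    then obtain u where u: "A = ennreal u" "u \<ge> 0" by (cases A) auto
    hence "s * u \<le> t" using A(2) that s by (simp add: ennreal_mult[symmetric])
    thus ?thesis using u s by (simp add: field_simps ennreal_leI)
  qed
  have "1 \<le> \<alpha>" "1 \<le> \<beta>" using \<open>min \<alpha> \<beta> = 1\<close> by (metis min.cobounded1 min.cobounded2)+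
  have num: "3 * ennreal t = ennreal (3 * t)" if "t \<ge> 0" for t
    using ennreal_mult[of 3 t] that by simp
  \<comment> \<open>The first case covers semivaluations that are infinite on y. In the last one
    \<alpha> may be any value from 1 up to infinity.\<close>
  consider "\<alpha> = 1" "\<beta> = \<infinity>" | t where "\<alpha> = 1" "\<beta> = ennreal t" "t \<ge> 1" | "\<beta> = 1"
    using \<open>min \<alpha> \<beta> = 1\<close> \<open>1 \<le> \<beta>\<close> by (cases \<beta>) (auto simp: min_def split: if_splits)
  thus ?thesis
  proof cases
    case 1
    \<comment> \<open>With y infinite only x^3 has finite value, and A \<le> 1 with 1 + s < 3 gives
      strictness.\<close>
    hence "ennreal 3 \<le> B" using B by (simp add: ennreal_mult_top)
    thus ?thesis using strict[of 1 3] A 1 s by simp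
  next
    case (2 t)
    have "3 * \<alpha> = ennreal 3" "\<alpha> + \<beta> = ennreal (1 + t)" "3 * \<beta> = ennreal (3 * t)"
      using 2 num[of t] by simp_all
    hence "ennreal (min 3 (1 + t)) \<le> min (3 * \<alpha>) (min (\<alpha> + \<beta>) (3 * \<beta>))"
      using 2 by (simp only:) (intro min.boundedI ennreal_leI; simp)
    hence B': "ennreal (min 3 (1 + t)) \<le> B" using B by (rule order_trans)
    show ?thesis
    proof (cases "t = s")
      case True
      with B' s have "ennreal (1 + s) \<le> B" by simp
      thus ?thesis using ennreal_divide_le[of A 1 "1 + s" B] A 2 True s by simp
    next
      case False
      show ?thesis
      proof (cases "t < s")
        case True
        \<comment> \<open>Below s the bound on y controls A; as t < 2, the minimum in
          \<open>B'\<close> is 1 + t.\<close>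
        have "t / s * (1 + s) < 1 + t" 
        proof -
          have "t * (1 + s) < s * (1 + t)" using True by (simp add: algebra_simps)
          thus ?thesis using s by (simp add: divide_less_eq mult.commute)
        qed
        thus ?thesis using strict[of "t / s" "1 + t"] As[of t] B' 2 True s by simp
      next
        case False
        \<comment> \<open>Above s the bound A \<le> 1 from x takes over, and 1 + s lies below both 3
          and 1 + t.\<close>
        with \<open>t \<noteq> s\<close> show ?thesis using strict[of 1 "min 3 (1 + t)"] A B' 2 s by simp
      qed
    qed
  next
    case 3
    \<comment> \<open>When v(y) = 1 the numerator is at most 1/s, so a denominator of at least 2
      suffices because s > 1.\<close>
    have "ennreal 2 \<le> B"
    proof (rule order_trans[OF _ B])
      have "(2::ennreal) \<le> \<alpha> + 1" using add_mono[OF \<open>1 \<le> \<alpha>\<close> order_refl[of "1::ennreal"]] by simp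
      moreover have "(2::ennreal) \<le> 3 * \<alpha>"
        using mult_mono[of "2::ennreal" 3 1 \<alpha>] \<open>1 \<le> \<alpha>\<close> by simp
      ultimately show "ennreal 2 \<le> min (3 * \<alpha>) (min (\<alpha> + \<beta>) (3 * \<beta>))" using 3 by simp
    qed
    moreover have "1 / s * (1 + s) < 2" using s by (simp add: field_simps)
    ultimately show ?thesis using strict[of "1 / s" 2] As[of 1] 3 s by simp
  qed
qed

text \<open>The second bound comes from y^k, which lies in a_p for p = \<open>\<lfloor>k s\<rfloor>\<close>, letting k tend to infinity.\<close>

lemma val_filtration_monomial_le:
  assumes v: "v \<in> Val M" and s: "s \<ge> 1" "s \<notin> \<rat>"
    and a_def: "a = (\<lambda>p. {f. of_nat p \<le> monomial_valuation s f})"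
  shows "val_filtration v a \<le> v var_x" "ennreal s * val_filtration v a \<le> v var_y"
proof -
  have vs: "monomial_valuation s \<in> Val max_ideal2"
    using monomial_valuation_Val[OF s] by (simp add: Val_normalized_def)
  have a: "filtration type_ring a"
    unfolding a_def by (rule filtration_Val_ge[OF vs])
  let ?A = "val_filtration v a"
  have "var_x \<in> a 1" by (simp add: a_def monomial_valuation_var_x)
  from val_filtration_le[OF v a _ this] show "?A \<le> v var_x" by (simp add: divide_ennreal_def)
  have le: "?A \<le> of_nat k * v var_y / of_nat p" if "p \<ge> 1" "real p \<le> real k * s" for p k
  proof -
    have "monomial_valuation s (var_y ^ k) = ennreal (real k * s)"
      using s by (simp add: Val_power[OF vs] monomial_valuation_var_y ennreal_mult ennreal_of_nat_eq_real_of_nat)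
    hence "var_y ^ k \<in> a p" using that by (simp add: a_def ennreal_of_nat_eq_real_of_nat ennreal_leI)
    from val_filtration_le[OF v a that(1) this] show ?thesis by (simp add: Val_power[OF v])
  qed
  show "ennreal s * ?A \<le> v var_y"
  proof (cases "v var_y")
    case (real \<beta>)
    \<comment> \<open>Since s \<ge> 1, y itself lies in the first member, giving the finite bound
      v(y).\<close>
    have "?A < \<infinity>"
      using le[of 1 1] s real by (auto simp: divide_ennreal_def intro: le_less_trans)
    then obtain u where u: "?A = ennreal u" "u \<ge> 0" by (cases ?A) auto
    have "s * u \<le> \<beta>"
    proof (rule ccontr)
      assume "\<not> s * u \<le> \<beta>"
      \<comment> \<open>Rounding k s down to p loses at most 1, which costs at most u in u p \<le> k
        \<beta>. A k whose gain k (s u - \<beta>) exceeds u gives the contradiction.\<close>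
      then obtain k :: nat where k: "u < real k * (s * u - \<beta>)"
        using reals_Archimedean3[of "s * u - \<beta>"] by auto
      have "k \<noteq> 0" using k u by (cases k) auto
      define p where "p = nat \<lfloor>real k * s\<rfloor>"
      have "1 \<le> real k * s" using \<open>k \<noteq> 0\<close> s mult_mono[of 1 "real k" 1 s] by simp
      hence p: "p \<ge> 1" "real p \<le> real k * s" "real k * s - 1 \<le> real p"
        unfolding p_def by linarith+
      have "ennreal u \<le> ennreal (real k * \<beta> / real p)"
        using le[OF p(1,2)] u real p(1)
        by (simp add: ennreal_of_nat_eq_real_of_nat ennreal_mult[symmetric] divide_ennreal)
      hence "u * real p \<le> real k * \<beta>"
        using real p(1) by (simp add: ennreal_le_iff field_simps)
      moreover have "u * (real k * s - 1) \<le> u * real p" using p(3) u by (intro mult_left_mono)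
      ultimately show False using k by (simp add: algebra_simps)
    qed
    thus ?thesis using u real s by (simp add: ennreal_mult[symmetric] ennreal_leI)
  qed simp
qed

section \<open>The example with weight the square root of 2\<close>

lemma sqrt_2_irrational: "sqrt 2 \<notin> \<rat>"
proof
  assume "sqrt 2 \<in> \<rat>"
  then obtain m n :: nat where n: "n \<noteq> 0" and eq: "\<bar>sqrt 2\<bar> = real m / real n" and "coprime m n"
    by (rule Rats_abs_nat_div_natE)
  have "real m ^ 2 = 2 * real n ^ 2"
  proof -
    have "real m = sqrt 2 * real n" using eq n by (simp add: field_simps)
    thus ?thesis by (simp add: power_mult_distrib)
  qed
  hence eq: "m ^ 2 = 2 * n ^ 2" by (metis of_nat_eq_iff of_nat_mult of_nat_numeral of_nat_power)
  hence "even m" by (metis dvd_triv_left even_power)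
  then obtain k where "m = 2 * k" by blast
  with eq have "n ^ 2 = 2 * k ^ 2" by (simp add: power2_eq_square)
  hence "even n" by (metis dvd_triv_left even_power)
  with \<open>even m\<close> \<open>coprime m n\<close> show False using coprime_common_divisor[of m n 2] by simp
qed

theorem theorem5p16:
  fixes R :: "power_series2 ring" and \<mm> \<qq> :: "power_series2 set"
  assumes "R = power_series_ring2" and "\<mm> = max_ideal2" and "\<qq> = \<mm>"
  shows "\<exists>a b. filtration R a \<and> filtration R b \<and>
    (\<exists>c>0. \<exists>C>0. \<forall>p\<ge>1.
        ideal_power R \<qq> (nat \<lceil>c * real p\<rceil>) \<subseteq> a p \<and>
        a p \<subseteq> ideal_power R \<qq> (nat \<lfloor>C * real p\<rfloor>)) \<and>
    (\<exists>d>0. \<exists>D>0. \<forall>p\<ge>1.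
        ideal_power R \<qq> (nat \<lceil>d * real p\<rceil>) \<subseteq> b p \<and>
        b p \<subseteq> ideal_power R \<qq> (nat \<lfloor>D * real p\<rfloor>)) \<and>
    (\<exists>v'\<in>Val_normalized \<mm> \<qq>.
        val_filtration v' a / val_filtration v' b
          = (SUP v\<in>Val_normalized \<mm> \<qq>. val_filtration v a / val_filtration v b) \<and>
        \<not> divisorial v') \<and>
    (\<forall>w\<in>Val_normalized \<mm> \<qq>. divisorial w \<longrightarrow>
        val_filtration w a / val_filtration w b
          \<noteq> (SUP v\<in>Val_normalized \<mm> \<qq>. val_filtration v a / val_filtration v b))"
proof -
  have eqs: "R = type_ring" "\<mm> = max_ideal2" "\<qq> = max_ideal2"
    using assms by (simp_all add: power_series_ring2_eq)
  define s :: real where "s = sqrt 2"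
  \<comment> \<open>The bounds place s strictly inside the range where x y determines the value of
    the ideal. Irrationality makes \<open>v'\<close> multiplicative and excludes divisorial
    maximizers.\<close>
  have s: "1 < s" "s < 2" "s \<notin> \<rat>"
    using sqrt_2_irrational by (auto simp: s_def real_less_lsqrt)
  let ?Val = "Val_normalized max_ideal2 max_ideal2"
  define v' where "v' = monomial_valuation s"
  have v'_norm: "v' \<in> ?Val"
    unfolding v'_def using s by (intro monomial_valuation_Val) auto
  hence v': "v' \<in> Val max_ideal2" by (simp add: Val_normalized_def)
  define a where "a = (\<lambda>p. {f. of_nat p \<le> v' f})"
  define b where "b = ideal_power type_ring three_vertex_ideal"
  have a: "filtration type_ring a" unfolding a_def by (rule filtration_Val_ge[OF v'])
  have one: "1 \<notin> max_ideal2"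
  proof
    assume "1 \<in> max_ideal2"
    hence "0 < v' 1" using v' by (auto simp: Val_def)
    thus False by (simp add: Val_1[OF v'])
  qed
  hence b: "filtration type_ring b"
    unfolding b_def using three_vertex_ideal_subset by (intro filtration_ideal_power ideal_three_vertex_ideal) auto
  define ratio where "ratio = (\<lambda>v. val_filtration v a / val_filtration v b)"
  have bound: "ratio v < ennreal (1 / (1 + s)) \<or>
      (v var_x = 1 \<and> v var_y = ennreal s \<and> ratio v \<le> ennreal (1 / (1 + s)))" if "v \<in> ?Val" for v
  proof -
    have v: "v \<in> Val max_ideal2" and m: "min (v var_x) (v var_y) = 1"
      using that val_max_ideal2 by (auto simp: Val_normalized_def)
    have "val_ideal v three_vertex_ideal \<le> val_filtration v b"
      using Val_ideal_power_ge[OF v] unfolding b_def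
      by (intro val_filtration_ge[OF v b[unfolded b_def]])
    thus ?thesis
      unfolding ratio_def val_three_vertex_ideal[OF v]
      using ratio_bound[OF s(1,2) m] val_filtration_monomial_le[OF v _ s(3), of a] s
      by (simp add: a_def v'_def)
  qed
  have ratio_v': "ratio v' = ennreal (1 / (1 + s))"
  proof (rule antisym)
    have A: "1 \<le> val_filtration v' a"
      by (rule val_filtration_ge[OF v' a]) (simp add: a_def)
    \<comment> \<open>The generator x y has weight 1 + s, so it bounds the denominator by the
      optimal value.\<close>
    have "var_x * var_y \<in> b 1"
      using three_vertex_ideal_gens by (simp add: b_def ideal_power_1[OF ideal_three_vertex_ideal, simplified])
    from val_filtration_le[OF v' b _ this] have "val_filtration v' b \<le> ennreal (1 + s)"
      using s by (simp add: divide_ennreal_def Val_mult[OF v', unfolded v'_def] v'_def monomial_valuation_var_x monomial_valuation_var_y)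
    hence "1 / ennreal (1 + s) \<le> ratio v'"
      unfolding ratio_def divide_ennreal_def using A by (intro mult_mono ennreal_inverse_antimono) auto
    moreover have "1 / ennreal (1 + s) = ennreal (1 / (1 + s))"
      using s divide_ennreal[of 1 "1 + s"] by simp
    ultimately show "ennreal (1 / (1 + s)) \<le> ratio v'" by simp
    show "ratio v' \<le> ennreal (1 / (1 + s))" using bound[OF v'_norm] by auto
  qed
  have sup: "(SUP v\<in>?Val. ratio v) = ennreal (1 / (1 + s))"
  proof (rule antisym)
    show "(SUP v\<in>?Val. ratio v) \<le> ennreal (1 / (1 + s))"
      using bound by (intro SUP_least) (auto intro: less_imp_le)
    show "ennreal (1 / (1 + s)) \<le> (SUP v\<in>?Val. ratio v)"
      using SUP_upper[OF v'_norm, of ratio] ratio_v' by simp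
  qed
  \<comment> \<open>Equality rules out the strict alternative in \<open>bound\<close>, which forces
    v(x) = 1 and v(y) = s. As v is arbitrary, this serves both for \<open>v'\<close> and for the
    claim about all divisorial valuations.\<close>
  have nondiv: "\<not> divisorial v" if "v \<in> ?Val" "ratio v = ennreal (1 / (1 + s))" for v
  proof
    assume "divisorial v"
    moreover have "v var_x = ennreal 1" "v var_y = ennreal s" using bound[OF that(1)] that(2) by auto
    ultimately have "s / 1 \<in> \<rat>" using s by (intro divisorial_values_commensurable[of v var_x 1 var_y s]) auto
    thus False using s by simp
  qed
  \<comment> \<open>The constant c = 1 reflects the normalization of \<open>v'\<close> on the
    maximal ideal.\<close>
  have a_lower: "ideal_power type_ring max_ideal2 (nat \<lceil>1 * real p\<rceil>) \<subseteq> a p" for p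
    using Val_ideal_power_ge[OF v', of _ max_ideal2 p] v'_norm
    by (auto simp: a_def Val_normalized_def)
  have a_upper: "a p \<subseteq> ideal_power type_ring max_ideal2 (nat \<lfloor>1 / 2 * real p\<rfloor>)" for p
  proof
    fix f assume "f \<in> a p"
    hence *: "of_nat p \<le> monomial_valuation s f" by (simp add: a_def v'_def)
    show "f \<in> ideal_power type_ring max_ideal2 (nat \<lfloor>1 / 2 * real p\<rfloor>)"
    proof (rule in_max_ideal2_powerI)
      fix i j assume "f $ j $ i \<noteq> 0"
      with * have "ennreal (real p) \<le> ennreal (real i + s * real j)"
        by (simp add: le_monomial_valuation_iff ennreal_of_nat_eq_real_of_nat)
      hence "real p \<le> real i + s * real j" using s by (subst (asm) ennreal_le_iff) auto
      \<comment> \<open>The weight is at most twice the degree because s < 2, hence the constant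
        1/2.\<close>
      moreover have "s * real j \<le> 2 * real j" using s by (intro mult_right_mono) auto
      ultimately show "nat \<lfloor>1 / 2 * real p\<rfloor> \<le> i + j" by linarith
    qed
  qed
  \<comment> \<open>The constant 3 comes from the cube of the maximal ideal lying in the
    three-vertex ideal, raised to the power p.\<close>
  have b_lower: "ideal_power type_ring max_ideal2 (nat \<lceil>3 * real p\<rceil>) \<subseteq> b p" for p
  proof -
    have "nat \<lceil>3 * real p\<rceil> = 3 * p" by linarith
    thus ?thesis
      using ideal_power_mono[OF max_ideal2_cubed_subset, of p]
      by (simp add: b_def ideal_power_mult[OF ideal_max_ideal2])
  qed
  have b_upper: "b p \<subseteq> ideal_power type_ring max_ideal2 (nat \<lfloor>1 * real p\<rfloor>)" for p
    using ideal_power_mono[OF three_vertex_ideal_subset, of p] by (simp add: b_def)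
  show ?thesis
    unfolding eqs
  proof (rule exI[of _ a], rule exI[of _ b], intro conjI a b)
    show "\<exists>c>0. \<exists>C>0. \<forall>p\<ge>1. ideal_power type_ring max_ideal2 (nat \<lceil>c * real p\<rceil>) \<subseteq> a p \<and>
        a p \<subseteq> ideal_power type_ring max_ideal2 (nat \<lfloor>C * real p\<rfloor>)"
      by (rule exI[of _ 1], rule conjI[OF zero_less_one], rule exI[of _ "1 / 2"])
        (use a_lower a_upper in auto)
    show "\<exists>d>0. \<exists>D>0. \<forall>p\<ge>1. ideal_power type_ring max_ideal2 (nat \<lceil>d * real p\<rceil>) \<subseteq> b p \<and>
        b p \<subseteq> ideal_power type_ring max_ideal2 (nat \<lfloor>D * real p\<rfloor>)"
      by (rule exI[of _ 3], rule conjI, simp, rule exI[of _ 1]) (use b_lower b_upper in auto)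
  qed (use sup nondiv v'_norm ratio_v' in \<open>auto simp: ratio_def\<close>)
qed

end
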